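(* If $\ell=0$, then $$\operatorname{Sc}(V_{\widehat{\mathfrak{sl}}_2}(\ell,0),\omega)=\{0\}\cup\{\omega\}.$$
   Context: On $\mathfrak{sl}_2=\mathfrak{sl}_2(\mathbb{C})$ with standard basis $h,e,f$ use the normalized Killing form $\langle h,h\rangle=2$, $\langle e,f\rangle=1$, all other pairings of basis elements being $0$. An orthonormal basis is $\alpha_1=\frac{e+f}{\sqrt2}$, $\alpha_2=\frac{e-f}{\sqrt{-2}}$, $\alpha_3=\frac{h}{\sqrt2}$. $\widehat{\mathfrak{sl}}_2=\mathfrak{sl}_2\otimes\mathbb{C}[t,t^{-1}]\oplus\mathbb{C}K$, $a(n)=a\otimes t^n$, $[a(n),b(m)]=[a,b](n+m)+n\delta_{n+m,0}\langle a,b\rangle K$, $K$ central. $V_{\widehat{\mathfrak{sl}}_2}(\ell,0)$ is the universal affine vertex operator algebra of level $\ell\ne-2$ (induced from the one-dimensional module $\mathbb{C}\mathbf{1}$ of $\mathfrak{sl}_2\otimes\mathbb{C}[t]\oplus\mathbb{C}K$ on which $\mathfrak{sl}_2\otimes\mathbb{C}[t]$ acts by $0$ and $K$ by $\ell$), with conformal vector $\omega=\frac{1}{2(\ell+2)}\sum_{i=1}^3\alpha_i(-1)^2\mathbf{1}$. For a vertex operator algebra $(V,\omega)$ write $Y(v,z)=\sum_n v_nz^{-n-1}$. A vector $\omega'\in V$ is semi-conformal if there is a vertex subalgebra $U\subseteq V$ such that $(U,\omega')$ is a vertex operator algebra with conformal vector $\omega'$ and $\omega'_n|_U=\omega_n|_U$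 for all $n\ge0$; $\operatorname{Sc}(V,\omega)$ is the set of semi-conformal vectors. *)

theory Defs
  imports Complex_Main "HOL-Library.Poly_Mapping"
begin

section \<open>Vertex algebras and vertex operator algebras\<close>

text \<open>
  The state space is a subspace \<open>V\<close> of an ambient complex vector space, so that a vertex algebra
  and its vertex subalgebras are instances of one notion. The value \<open>Y u n\<close> is the mode \<open>u\<^sub>n\<close>,
  that is \<open>Y(u,z) = \<Sum>\<^sub>n u\<^sub>n z^(-n-1)\<close>. The Jacobi identity is stated in components
  (the Borcherds identity). Its sums over \<open>j\<close> have finite support by \<open>truncation\<close>,
  and \<open>Sum_any\<close> is the sum of a function over its support.
\<close>

locale vertex_algebra = vector_space scale
  for scale :: "complex \<Rightarrow> 'v::ab_group_add \<Rightarrow> 'v" +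
  fixes V :: "'v set" and Y :: "'v \<Rightarrow> int \<Rightarrow> 'v \<Rightarrow> 'v" and vac :: 'v
  assumes subspace_V: "subspace V"
    and mode_closed: "\<lbrakk>u \<in> V; v \<in> V\<rbrakk> \<Longrightarrow> Y u n v \<in> V"
    and mode_add_left: "\<lbrakk>u \<in> V; u' \<in> V; v \<in> V\<rbrakk> \<Longrightarrow> Y (u + u') n v = Y u n v + Y u' n v"
    and mode_scale_left: "\<lbrakk>u \<in> V; v \<in> V\<rbrakk> \<Longrightarrow> Y (scale c u) n v = scale c (Y u n v)"
    and mode_add_right: "\<lbrakk>u \<in> V; v \<in> V; v' \<in> V\<rbrakk> \<Longrightarrow> Y u n (v + v') = Y u n v + Y u n v'"
    and mode_scale_right: "\<lbrakk>u \<in> V; v \<in> V\<rbrakk> \<Longrightarrow> Y u n (scale c v) = scale c (Y u n v)"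
    and truncation: "\<lbrakk>u \<in> V; v \<in> V\<rbrakk> \<Longrightarrow> \<exists>N. \<forall>n\<ge>N. Y u n v = 0"
    and vac_in_V: "vac \<in> V"
    and vacuum: "v \<in> V \<Longrightarrow> Y vac n v = (if n = -1 then v else 0)"
    and creation: "v \<in> V \<Longrightarrow> Y v (-1) vac = v"
      "\<lbrakk>v \<in> V; n \<ge> 0\<rbrakk> \<Longrightarrow> Y v n vac = 0"
    and jacobi: "\<lbrakk>u \<in> V; v \<in> V; w \<in> V\<rbrakk> \<Longrightarrow>
      Sum_any (\<lambda>j::nat. scale (of_int m gchoose j) (Y (Y u (l + int j) v) (m + n - int j) w)) =
      Sum_any (\<lambda>j::nat. scale ((-1) ^ j * (of_int l gchoose j))
        (Y u (m + l - int j) (Y v (n + int j) w)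
          - scale ((-1) powi l) (Y v (n + l - int j) (Y u (m + int j) w))))"

definition (in vertex_algebra) weight_space :: "'v \<Rightarrow> int \<Rightarrow> 'v set" where
  "weight_space \<omega> k = {v \<in> V. Y \<omega> 1 v = scale (of_int k) v}"

text \<open>
  Writing \<open>L(n) = \<omega>\<^sub>n\<^sub>+\<^sub>1\<close>. Eigenspaces of \<open>L(0)\<close> for distinct eigenvalues are independent,
  so \<open>graded\<close> says that \<open>V\<close> is the direct sum of its weight spaces.
\<close>

locale vertex_operator_algebra = vertex_algebra scale V Y vac
  for scale :: "complex \<Rightarrow> 'v::ab_group_add \<Rightarrow> 'v" and V Y vac +
  fixes \<omega> :: 'v
  assumes \<omega>_in_V: "\<omega> \<in> V"
    and virasoro: "\<exists>c::complex. \<forall>m n. \<forall>v\<in>V.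
      Y \<omega> (m + 1) (Y \<omega> (n + 1) v) - Y \<omega> (n + 1) (Y \<omega> (m + 1) v) =
        scale (of_int (m - n)) (Y \<omega> (m + n + 1) v)
        + (if m + n = 0 then scale ((of_int m ^ 3 - of_int m) / 12 * c) v else 0)"
    and derivative: "\<lbrakk>u \<in> V; v \<in> V\<rbrakk> \<Longrightarrow> Y (Y \<omega> 0 u) n v = scale (- of_int n) (Y u (n - 1) v)"
    and graded: "V = span (\<Union>k::int. weight_space \<omega> k)"
    and finite_dim: "\<exists>B. finite B \<and> weight_space \<omega> k \<subseteq> span B"
    and bounded_below: "\<exists>N::int. \<forall>k<N. weight_space \<omega> k = {0}"

definition vertex_subalgebra ::
  "(complex \<Rightarrow> 'v::ab_group_add \<Rightarrow> 'v) \<Rightarrow> 'v set \<Rightarrow> ('v \<Rightarrow> int \<Rightarrow> 'v \<Rightarrow> 'v) \<Rightarrow> 'v \<Rightarrow> 'v set \<Rightarrow> bool"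
  where "vertex_subalgebra scale V Y vac U \<longleftrightarrow>
    U \<subseteq> V \<and> module.subspace scale U \<and> vac \<in> U \<and> (\<forall>u\<in>U. \<forall>v\<in>U. \<forall>n. Y u n v \<in> U)"

definition Sc ::
  "(complex \<Rightarrow> 'v::ab_group_add \<Rightarrow> 'v) \<Rightarrow> 'v set \<Rightarrow> ('v \<Rightarrow> int \<Rightarrow> 'v \<Rightarrow> 'v) \<Rightarrow> 'v \<Rightarrow> 'v \<Rightarrow> 'v set"
  where "Sc scale V Y vac \<omega> = {\<omega>' \<in> V. \<exists>U. vertex_subalgebra scale V Y vac U
    \<and> vertex_operator_algebra scale U Y vac \<omega>'
    \<and> (\<forall>n\<ge>0. \<forall>u\<in>U. Y \<omega>' n u = Y \<omega> n u)}"

section \<open>The Lie algebra \<open>sl\<^sub>2\<close>\<close>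

datatype sl2_basis = sl2_H | sl2_E | sl2_F

text \<open>Elements of \<open>sl\<^sub>2\<close> are given by their coordinates in the basis \<open>h, e, f\<close>.\<close>

type_synonym sl2 = "sl2_basis \<Rightarrow> complex"

definition sl2_vec :: "sl2_basis \<Rightarrow> sl2" where
  "sl2_vec x = (\<lambda>y. if y = x then 1 else 0)"

fun sl2_bracket :: "sl2_basis \<Rightarrow> sl2_basis \<Rightarrow> sl2" where
  "sl2_bracket sl2_H sl2_E = (\<lambda>x. 2 * sl2_vec sl2_E x)"
| "sl2_bracket sl2_E sl2_H = (\<lambda>x. - 2 * sl2_vec sl2_E x)"
| "sl2_bracket sl2_H sl2_F = (\<lambda>x. - 2 * sl2_vec sl2_F x)"
| "sl2_bracket sl2_F sl2_H = (\<lambda>x. 2 * sl2_vec sl2_F x)"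
| "sl2_bracket sl2_E sl2_F = sl2_vec sl2_H"
| "sl2_bracket sl2_F sl2_E = (\<lambda>x. - sl2_vec sl2_H x)"
| "sl2_bracket _ _ = (\<lambda>x. 0)"

fun killing :: "sl2_basis \<Rightarrow> sl2_basis \<Rightarrow> complex" where
  "killing sl2_H sl2_H = 2"
| "killing sl2_E sl2_F = 1"
| "killing sl2_F sl2_E = 1"
| "killing _ _ = 0"

definition alpha1 :: sl2 where "alpha1 = (\<lambda>x. (sl2_vec sl2_E x + sl2_vec sl2_F x) / csqrt 2)"
definition alpha2 :: sl2 where "alpha2 = (\<lambda>x. (sl2_vec sl2_E x - sl2_vec sl2_F x) / csqrt (-2))"
definition alpha3 :: sl2 where "alpha3 = (\<lambda>x. sl2_vec sl2_H x / csqrt 2)"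

section \<open>The affine Lie algebra and its vacuum module\<close>

text \<open>
  \<open>Cur x n\<close> is the basis element \<open>x(n) = x \<otimes> t^n\<close> of the affine Lie algebra, \<open>Cen\<close> is \<open>K\<close>.
  With concatenation of lists as addition, \<open>affine_gen list \<Rightarrow>\<^sub>0 complex\<close> with the convolution
  product of \<open>Poly_Mapping\<close> is the free associative algebra on this basis, i.e. the tensor
  algebra of the affine Lie algebra.
\<close>

datatype affine_gen = Cur sl2_basis int | Cen

instantiation list :: (type) monoid_add
begin
definition zero_list :: "'a list" where "0 = []"
definition plus_list :: "'a list \<Rightarrow> 'a list \<Rightarrow> 'a list" where "xs + ys = xs @ ys"
instance by intro_classes (simp_all add: zero_list_def plus_list_def)
end

type_synonym tensor_alg = "affine_gen list \<Rightarrow>\<^sub>0 complex"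

definition scalar :: "complex \<Rightarrow> tensor_alg" where
  "scalar c = Poly_Mapping.single [] c"

definition gen :: "affine_gen \<Rightarrow> tensor_alg" where
  "gen g = Poly_Mapping.single [g] 1"

definition current :: "sl2 \<Rightarrow> int \<Rightarrow> tensor_alg" where
  "current a n = (\<Sum>x\<in>{sl2_H, sl2_E, sl2_F}. scalar (a x) * gen (Cur x n))"

fun affine_bracket :: "affine_gen \<Rightarrow> affine_gen \<Rightarrow> tensor_alg" where
  "affine_bracket (Cur x n) (Cur y m) = current (sl2_bracket x y) (n + m)
     + (if n + m = 0 then scalar (of_int n * killing x y) * gen Cen else 0)"
| "affine_bracket _ _ = 0"

text \<open>
  The kernel of the map \<open>u \<mapsto> u \<cdot> 1\<close> from the tensor algebra onto the induced module.
  Dividing by \<open>commutator\<close> alone gives the universal enveloping algebra; \<open>annihilate\<close> and \<open>level\<close>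
  then generate the left ideal of \<open>u \<mapsto> u \<otimes> 1\<close> for the one-dimensional module on which
  \<open>x(n)\<close> with \<open>n \<ge> 0\<close> acts by \<open>0\<close> and \<open>K\<close> by \<open>lev\<close>.
\<close>

inductive_set vacuum_ideal :: "complex \<Rightarrow> tensor_alg set" for lev :: complex where
  zero: "0 \<in> vacuum_ideal lev"
| add: "\<lbrakk>u \<in> vacuum_ideal lev; w \<in> vacuum_ideal lev\<rbrakk> \<Longrightarrow> u + w \<in> vacuum_ideal lev"
| commutator: "u * (gen g * gen g' - gen g' * gen g - affine_bracket g g') * w \<in> vacuum_ideal lev"
| annihilate: "n \<ge> 0 \<Longrightarrow> u * gen (Cur x n) \<in> vacuum_ideal lev"
| level: "u * (gen Cen - scalar lev) \<in> vacuum_ideal lev"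

section \<open>The universal affine vertex operator algebra\<close>

text \<open>
  The ambient type is the induced module: \<open>q\<close> is the quotient map \<open>u \<mapsto> u \<cdot> 1\<close>, so \<open>q 1\<close> is the
  vacuum and \<open>a(n)\<close> acts by \<open>q u \<mapsto> q (current a n * u)\<close>. The vertex algebra structure is the one
  with \<open>Y(a(-1)1,z) = \<Sum>\<^sub>n a(n) z^(-n-1)\<close>, which determines \<open>Y\<close> uniquely as the \<open>a(-1)1\<close> generate.
  Conformality of the Sugawara vector below is not part of the assumptions.
\<close>

locale universal_affine_sl2 = vertex_algebra scale UNIV Y "q 1"
  for scale :: "complex \<Rightarrow> 'v::ab_group_add \<Rightarrow> 'v" and Y and q :: "tensor_alg \<Rightarrow> 'v" +
  fixes lev :: complex
  assumes noncritical: "lev \<noteq> -2"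
    and q_add: "q (u + w) = q u + q w"
    and q_scale: "q (scalar c * u) = scale c (q u)"
    and q_surj: "surj q"
    and q_kernel: "q u = 0 \<longleftrightarrow> u \<in> vacuum_ideal lev"
    and Y_current: "Y (q (current a (-1))) n (q u) = q (current a n * u)"

definition sugawara :: "(tensor_alg \<Rightarrow> 'v) \<Rightarrow> complex \<Rightarrow> 'v" where
  "sugawara q lev = q (scalar (1 / (2 * (lev + 2))) *
     (current alpha1 (-1) ^ 2 + current alpha2 (-1) ^ 2 + current alpha3 (-1) ^ 2))"

end

(* The Sugawara vector acts by L(n) with [L(n), x(m)] = -m x(m+n), which determines everything on the
   span of monomials applied to the vacuum and makes the whole space a vertex operator algebra with c = 0.

   Conversely a semi-conformal w satisfies L(0)w = 2w and L(1)w = 0, hence is a symmetric quadratic vector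
   sum A_ij alpha_i(-1)alpha_j(-1)1, and w_1 w = 2w. With A = lambda I + A_0, tr A_0 = 0, and at level 0,
   this says A_0^2 = m A_0 + t I with m = lambda - 1/8, and 2 m^2 - t = 1/32. Cayley-Hamilton for A_0
   turns the first equation into (2 m^2 - t) A_0 = 0, so A_0 = 0 and lambda is 0 or 1/4.

   No PBW theorem is needed to compare coefficients: the traceless part is the irreducible sl_2-module
   generated by e(-1)e(-1)1, which is either 0 or five-dimensional, and the rest is a multiple of omega. *)
theory Submission
  imports Defs
begin

section \<open>Borcherds identities\<close>

context vertex_algebra
begin

lemma Sum_any_single:
  assumes "\<And>j. j \<noteq> i \<Longrightarrow> f j = (0::'v)"
  shows "Sum_any f = f (i::nat)"
proof -
  have "Sum_any f = sum f {i}"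
    by (rule Sum_any.expand_superset) (use assms in auto)
  then show ?thesis by simp
qed

lemma mode_zero_left: "v \<in> V \<Longrightarrow> Y 0 n v = 0"
  using mode_scale_left[of 0 v 0 n] subspace_0[OF subspace_V] by simp

lemma mode_zero_right: "u \<in> V \<Longrightarrow> Y u n 0 = 0"
  using mode_scale_right[of u 0 n 0] subspace_0[OF subspace_V] by simp

text \<open>The Borcherds identity at \<open>l = 0\<close>: there \<open>0 gchoose j\<close> keeps
  only the term \<open>j = 0\<close> on the right.\<close>

lemma commutator_formula:
  assumes "u \<in> V" "v \<in> V" "w \<in> V"
  shows "Y u m (Y v n w) - Y v n (Y u m w) =
    Sum_any (\<lambda>j::nat. scale (of_int m gchoose j) (Y (Y u (int j) v) (m + n - int j) w))"
proof -
  have "Sum_any (\<lambda>j::nat. scale ((-1) ^ j * (of_int 0 gchoose j))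
        (Y u (m + 0 - int j) (Y v (n + int j) w)
          - scale ((-1) powi 0) (Y v (n + 0 - int j) (Y u (m + int j) w))))
     = Y u m (Y v n w) - Y v n (Y u m w)"
    by (subst Sum_any_single[where i = 0]) (auto simp: gbinomial_0_left)
  with jacobi[OF assms, of m 0 n] show ?thesis by simp
qed

text \<open>At \<open>m = 0\<close> the same vanishing collapses the other side of the Borcherds
  identity.\<close>

lemma iterate_formula:
  assumes "u \<in> V" "v \<in> V" "w \<in> V"
  shows "Y (Y u l v) n w = Sum_any (\<lambda>j::nat. scale ((-1) ^ j * (of_int l gchoose j))
        (Y u (l - int j) (Y v (n + int j) w)
          - scale ((-1) powi l) (Y v (n + l - int j) (Y u (int j) w))))"
proof -
  have "Sum_any (\<lambda>j::nat. scale (of_int 0 gchoose j) (Y (Y u (l + int j) v) (0 + n - int j) w))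
     = Y (Y u l v) n w"
    by (subst Sum_any_single[where i = 0]) (auto simp: gbinomial_0_left)
  with jacobi[OF assms, of 0 l n] show ?thesis by simp
qed

text \<open>The coefficients of (1 - x)^(-2), as they occur in the iterate formula for
  \<open>l = -2\<close>.\<close>

lemma gchoose_minus_2: "(-1) ^ j * ((-2::complex) gchoose j) = of_nat j + 1"
proof -
  have "((-2::complex) gchoose j) = (-1) ^ j * ((of_nat j + 1) gchoose j)"
    using gbinomial_minus[of "2::complex" j] by (simp add: add.commute)
  also have "(of_nat j + 1 :: complex) gchoose j = of_nat (Suc j choose j)"
    using binomial_gbinomial[of "Suc j" j, where ?'a = complex] by (simp add: add.commute)
  finally show ?thesis by (simp add: power_mult_distrib[symmetric] add.commute)
qed

text \<open>Here \<open>Y u (-2) vac\<close> serves as the translate of \<open>u\<close>. In the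
  iterate formula the vacuum contributes only through its mode -1, so at most one term is left, and
  the sign of \<open>n\<close> decides which.\<close>

lemma translation_mode:
  assumes u: "u \<in> V" and w: "w \<in> V"
  shows "Y (Y u (-2) vac) n w = scale (- of_int n) (Y u (n - 1) w)"
proof -
  let ?f = "\<lambda>j::nat. scale (of_nat j + 1)
        (Y u (-2 - int j) (Y vac (n + int j) w) - Y vac (n - 2 - int j) (Y u (int j) w))"
  have cl: "Y u k w \<in> V" for k using mode_closed u w by simp
  have "Y (Y u (-2) vac) n w = Sum_any ?f"
    using iterate_formula[OF u vac_in_V w, of "-2" n] by (simp add: gchoose_minus_2)
  also have "?f = (\<lambda>j. if n + int j = -1 then scale (of_nat j + 1) (Y u (-2 - int j) w)
       else if n - 2 - int j = -1 then - scale (of_nat j + 1) (Y u (int j) w) else 0)"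
    using u w cl by (auto simp: fun_eq_iff vacuum mode_zero_right scale_right_diff_distrib)
  also have "Sum_any \<dots> = scale (- of_int n) (Y u (n - 1) w)"
  proof (cases n "0::int" rule: linorder_cases)
    case less
    then have i: "n = -1 - int (nat (-1 - n))" by simp
    define i where "i = nat (-1 - n)"
    note i = i[folded i_def]
    have "Y u (- int i - 2) w = Y u (- 2 - int i) w"
      by (rule arg_cong[where f = "\<lambda>k. Y u k w"]) linarith
    then show ?thesis unfolding i
      by (subst Sum_any_single[where i = i]) (auto simp: add.commute)
  next
    case equal
    then show ?thesis
      by (subst Sum_any_single[where i = 0]) auto
  next
    case greater
    then have i: "n = 1 + int (nat (n - 1))" by simp
    define i where "i = nat (n - 1)"
    note i = i[folded i_def]
    show ?thesis unfolding i
      by (subst Sum_any_single[where i = i]) (auto simp: algebra_simps)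
  qed
  finally show ?thesis .
qed

text \<open>Writing T for \<open>\<lambda>u. Y u (-2) vac\<close>, this is [T, u(k)] = -k u(k-1).
  The creation property kills all terms of the iterate formula except \<open>j = 0\<close> and
  \<open>j = 1\<close>.\<close>

lemma translation_derivation:
  assumes u: "u \<in> V" and v: "v \<in> V"
  shows "Y (Y u k v) (-2) vac = Y u k (Y v (-2) vac) - scale (of_int k) (Y u (k - 1) v)"
proof -
  let ?f = "\<lambda>j::nat. scale ((-1) ^ j * (of_int k gchoose j)) (Y u (k - int j) (Y v (-2 + int j) vac))"
  have "Y (Y u k v) (-2) vac = Sum_any ?f"
    unfolding iterate_formula[OF u v vac_in_V]
    using u v by (simp add: creation mode_zero_right)
  also have "\<dots> = sum ?f {0, 1}"
  proof (rule Sum_any.expand_superset)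
    show "{j. ?f j \<noteq> 0} \<subseteq> {0, 1}"
    proof (rule subsetI, rule ccontr)
      fix j assume "j \<in> {j. ?f j \<noteq> 0}" "j \<notin> {0, 1}"
      moreover from this have "-2 + int j \<ge> 0" by auto
      then have "?f j = 0" using u v by (simp add: creation mode_zero_right)
      ultimately show False by simp
    qed
  qed simp
  also have "\<dots> = Y u k (Y v (-2) vac) - scale (of_int k) (Y u (k - 1) v)"
    using v by (simp add: creation)
  finally show ?thesis .
qed

lemma vertex_algebra_subalgebra:
  assumes "vertex_subalgebra scale V Y vac U"
  shows "vertex_algebra scale U Y vac"
proof -
  have U: "U \<subseteq> V" "subspace U" "vac \<in> U" "\<And>u v n. \<lbrakk>u \<in> U; v \<in> U\<rbrakk> \<Longrightarrow> Y u n v \<in> U"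
    using assms by (auto simp: vertex_subalgebra_def)
  have sub: "\<And>u. u \<in> U \<Longrightarrow> u \<in> V" using U by auto
  show ?thesis
    by unfold_locales
      (auto simp: U sub mode_add_left mode_add_right mode_scale_left mode_scale_right truncation
        vacuum creation intro!: jacobi)
qed

end

section \<open>The affine action at level 0\<close>

lemma poly_mapping_single_add_induct [case_names zero single_add]:
  fixes f :: "'a \<Rightarrow>\<^sub>0 'b::comm_monoid_add"
  assumes "P 0" and "\<And>k c f. P f \<Longrightarrow> P (Poly_Mapping.single k c + f)"
  shows "P f"
proof (induction f rule: update_induct)
  case const
  then show ?case by fact
next
  case (update f a b)
  have "Poly_Mapping.update a b f = Poly_Mapping.single a b + f"
    using update.hyps(1)
    by (intro poly_mapping_eqI) (auto simp: lookup_update lookup_add lookup_single in_keys_iff)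
  then show ?case using assms(2) update.IH by simp
qed

locale universal_affine_sl2_level_0 = universal_affine_sl2 scale Y q 0
  for scale :: "complex \<Rightarrow> 'v::ab_group_add \<Rightarrow> 'v" and Y q
begin

lemma current_vec: "current (sl2_vec x) n = gen (Cur x n)"
  by (cases x) (simp_all add: current_def sl2_vec_def scalar_def gen_def mult_single zero_list_def plus_list_def)

lemma current_add: "current (\<lambda>x. a x + b x) n = current a n + current b n"
  by (simp add: current_def scalar_def single_add distrib_right)

lemma scalar_mult: "scalar c * scalar d = scalar (c * d)"
  by (simp add: scalar_def mult_single plus_list_def)

lemma current_scale: "current (\<lambda>x. c * a x) n = scalar c * current a n"
  by (simp add: current_def scalar_mult[symmetric] distrib_left mult.assoc)

lemma q_zero: "q 0 = 0"
  using q_add[of 0 0] by simp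

lemma q_diff: "q (u - w) = q u - q w"
  using q_add[of "u - w" w] by simp

text \<open>Taken as a mode of a(-1)1, so that linearity and the Borcherds identities apply at once;
  \<open>act_q\<close> recovers left multiplication by \<open>current a n\<close>.\<close>

definition act :: "sl2 \<Rightarrow> int \<Rightarrow> 'v \<Rightarrow> 'v" where
  "act a n = Y (q (current a (-1))) n"

abbreviation vac :: 'v where "vac \<equiv> q 1"
abbreviation E :: "int \<Rightarrow> 'v \<Rightarrow> 'v" where "E \<equiv> act (sl2_vec sl2_E)"
abbreviation F :: "int \<Rightarrow> 'v \<Rightarrow> 'v" where "F \<equiv> act (sl2_vec sl2_F)"
abbreviation H :: "int \<Rightarrow> 'v \<Rightarrow> 'v" where "H \<equiv> act (sl2_vec sl2_H)"

lemma act_q: "act a n (q u) = q (current a n * u)"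
  by (simp add: act_def Y_current)

lemma act_add: "act a n (v + w) = act a n v + act a n w"
  by (simp add: act_def mode_add_right)

lemma act_scale: "act a n (scale c v) = scale c (act a n v)"
  by (simp add: act_def mode_scale_right)

lemma act_zero: "act a n 0 = 0"
  by (simp add: act_def mode_zero_right)

lemma act_minus: "act a n (- v) = - act a n v"
  using act_scale[of a n "-1" v] by simp

lemma act_diff: "act a n (v - w) = act a n v - act a n w"
  using act_add[of a n "v - w" w] by simp

lemmas act_linear = act_add act_scale act_zero act_minus act_diff

lemma act_left_add: "act (\<lambda>x. a x + b x) n v = act a n v + act b n v"
  by (simp add: act_def current_add q_add mode_add_left)

lemma act_left_scale: "act (\<lambda>x. c * a x) n v = scale c (act a n v)"
  by (simp add: act_def current_scale q_scale mode_scale_left)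

lemma act_left_minus: "act (\<lambda>x. - a x) n v = - act a n v"
  using act_left_scale[of "-1" a] by simp

lemma act_left_zero: "act (\<lambda>x. 0) n v = 0"
  using act_left_scale[of 0 a] by simp

lemma act_left_diff: "act (\<lambda>x. a x - b x) n v = act a n v - act b n v"
  using act_left_add[of a "\<lambda>x. - b x"] by (simp add: act_left_minus)

lemma act_vac: "n \<ge> 0 \<Longrightarrow> act a n vac = 0"
  by (simp add: act_def creation)

lemma Y_act_vac: "Y (act a (-1) vac) = act a"
  by (simp add: fun_eq_iff act_q) (simp add: act_def)

text \<open>K commutes past every letter of the words in \<open>w\<close>, and at the right end it
  acts by the level, which is 0.\<close>

lemma q_gen_Cen: "q (u * gen Cen * w) = 0"
proof -
  have *: "q (u * gen Cen * Poly_Mapping.single xs c) = 0" for u xs c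
  proof (induction xs arbitrary: u)
    case Nil
    have "u * gen Cen * Poly_Mapping.single [] c = u * scalar c * (gen Cen - scalar 0)"
      by (simp add: scalar_def gen_def mult.assoc mult_single plus_list_def)
    then show ?case using vacuum_ideal.level q_kernel by metis
  next
    case (Cons g xs)
    have s: "Poly_Mapping.single (g # xs) c = gen g * Poly_Mapping.single xs c"
      by (simp add: gen_def mult_single plus_list_def)
    have "u * (gen Cen * gen g - gen g * gen Cen - affine_bracket Cen g) * Poly_Mapping.single xs c \<in> vacuum_ideal 0"
      by (rule vacuum_ideal.commutator)
    then have "q (u * gen Cen * Poly_Mapping.single (g # xs) c
        - u * gen g * gen Cen * Poly_Mapping.single xs c) = 0"
      by (simp add: q_kernel s algebra_simps)
    then show ?case using Cons.IH[of "u * gen g"] by (simp add: q_diff)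
  qed
  show ?thesis
  proof (induction w rule: poly_mapping_single_add_induct)
    case zero
    then show ?case by (simp add: q_zero)
  next
    case (single_add k c f)
    then show ?case by (simp add: distrib_left q_add *)
  qed
qed

lemma act_vec_vec_vac:
  assumes "m \<ge> 0"
  shows "act (sl2_vec x) m (act (sl2_vec y) (-1) vac) = act (sl2_bracket x y) (m - 1) vac"
proof -
  let ?X = "gen (Cur x m)" and ?Y = "gen (Cur y (-1))"
  have "1 * (?X * ?Y - ?Y * ?X - affine_bracket (Cur x m) (Cur y (-1))) * 1 \<in> vacuum_ideal 0"
    by (rule vacuum_ideal.commutator)
  then have "q (?X * ?Y) - q (?Y * ?X) - q (affine_bracket (Cur x m) (Cur y (-1))) = 0"
    by (simp add: q_kernel flip: q_diff)
  moreover have "q (?Y * ?X) = 0"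
    using vacuum_ideal.annihilate[OF assms] by (simp add: q_kernel)
  moreover have "q (affine_bracket (Cur x m) (Cur y (-1))) = q (current (sl2_bracket x y) (m - 1))"
    using q_gen_Cen[of _ 1] by (simp add: q_add q_zero)
  ultimately show ?thesis by (simp only: act_q current_vec diff_zero right_minus_eq mult_1_right)
qed

text \<open>In the commutator formula the term \<open>j = 0\<close> gives the bracket. The terms
  with \<open>j \<ge> 1\<close> vanish, the one for \<open>j = 1\<close> because the level is
  0.\<close>

lemma act_commute:
  "act (sl2_vec x) m (act (sl2_vec y) n w) =
    act (sl2_vec y) n (act (sl2_vec x) m w) + act (sl2_bracket x y) (m + n) w"
proof -
  have "act (sl2_vec x) m (act (sl2_vec y) n w) - act (sl2_vec y) n (act (sl2_vec x) m w) =
    Sum_any (\<lambda>j::nat. scale (of_int m gchoose j)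
      (Y (act (sl2_vec x) (int j) (act (sl2_vec y) (-1) vac)) (m + n - int j) w))"
    using commutator_formula[of "act (sl2_vec x) (-1) vac" "act (sl2_vec y) (-1) vac" w m n]
    by (simp add: Y_act_vac)
  also have "\<dots> = Y (act (sl2_bracket x y) (-1) vac) (m + n) w"
    by (subst Sum_any_single[where i = 0]) (auto simp: act_vec_vec_vac act_vac mode_zero_left)
  also have "\<dots> = act (sl2_bracket x y) (m + n) w"
    by (simp add: Y_act_vac)
  finally show ?thesis by (simp add: algebra_simps)
qed

lemma act_bracket:
  "act (sl2_bracket sl2_H sl2_E) n v = scale 2 (E n v)"
  "act (sl2_bracket sl2_E sl2_H) n v = - scale 2 (E n v)"
  "act (sl2_bracket sl2_H sl2_F) n v = - scale 2 (F n v)"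
  "act (sl2_bracket sl2_F sl2_H) n v = scale 2 (F n v)"
  "act (sl2_bracket sl2_E sl2_F) n v = H n v"
  "act (sl2_bracket sl2_F sl2_E) n v = - H n v"
  "act (sl2_bracket x x) n v = 0"
  using act_left_scale[of "-2" "sl2_vec sl2_E" n v] act_left_scale[of "-2" "sl2_vec sl2_F" n v]
  by (auto simp: act_left_scale act_left_minus act_left_zero) (cases x; simp add: act_left_zero)

lemmas act_commute_basis =
  act_commute[of sl2_H _ sl2_E, unfolded act_bracket] act_commute[of sl2_E _ sl2_H, unfolded act_bracket]
  act_commute[of sl2_H _ sl2_F, unfolded act_bracket] act_commute[of sl2_F _ sl2_H, unfolded act_bracket]
  act_commute[of sl2_E _ sl2_F, unfolded act_bracket] act_commute[of sl2_F _ sl2_E, unfolded act_bracket]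
  act_commute[of x _ x for x, unfolded act_bracket]

text \<open>Restricted to \<open>m \<ge> 0 > n\<close>, the commutation rules move annihilation operators to the vacuum.
  The case of equal generators has fixed \<open>n\<close>, as the simplifier would treat it as permutative otherwise.\<close>

lemma act_sort:
  "m \<ge> 0 \<Longrightarrow> n < 0 \<Longrightarrow> H m (E n w) = E n (H m w) + scale 2 (E (m + n) w)"
  "m \<ge> 0 \<Longrightarrow> n < 0 \<Longrightarrow> E m (H n w) = H n (E m w) - scale 2 (E (m + n) w)"
  "m \<ge> 0 \<Longrightarrow> n < 0 \<Longrightarrow> H m (F n w) = F n (H m w) - scale 2 (F (m + n) w)"
  "m \<ge> 0 \<Longrightarrow> n < 0 \<Longrightarrow> F m (H n w) = H n (F m w) + scale 2 (F (m + n) w)"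
  "m \<ge> 0 \<Longrightarrow> n < 0 \<Longrightarrow> E m (F n w) = F n (E m w) + H (m + n) w"
  "m \<ge> 0 \<Longrightarrow> n < 0 \<Longrightarrow> F m (E n w) = E n (F m w) - H (m + n) w"
  "m \<ge> 0 \<Longrightarrow> act (sl2_vec x) m (act (sl2_vec x) (-1) w) = act (sl2_vec x) (-1) (act (sl2_vec x) m w)"
  "m \<ge> 0 \<Longrightarrow> act (sl2_vec x) m (act (sl2_vec x) (-2) w) = act (sl2_vec x) (-2) (act (sl2_vec x) m w)"
  by (simp_all only: act_commute_basis(1)[of m n w] act_commute_basis(2)[of m n w]
    act_commute_basis(3)[of m n w] act_commute_basis(4)[of m n w] act_commute_basis(5)[of m n w]
    act_commute_basis(6)[of m n w] act_commute_basis(7)[of x m "-1" w] act_commute_basis(7)[of x m "-2" w]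
    add_0_right diff_conv_add_uminus)

section \<open>The Casimir vector and its commutators with the currents\<close>

definition \<Omega> :: 'v where
  "\<Omega> = E (-1) (F (-1) vac) + F (-1) (E (-1) vac) + scale (1/2) (H (-1) (H (-1) vac))"

abbreviation \<omega> :: 'v where "\<omega> \<equiv> sugawara q 0"

text \<open>\<open>\<Omega>\<close> is the sum of the squares of the orthonormal basis, rewritten in
  h, e, f; the factor 1/(2(l + 2)) is 1/4 at level 0.\<close>

lemma sugawara_eq: "\<omega> = scale (1/4) \<Omega>"
proof -
  have sq: "q (current a (-1) ^ 2) = act a (-1) (act a (-1) vac)" for a
    by (simp add: act_q power2_eq_square)
  have a1: "act alpha1 n v = scale (1 / csqrt 2) (E n v + F n v)" for n v
    using act_left_scale[of "1 / csqrt 2" "\<lambda>x. sl2_vec sl2_E x + sl2_vec sl2_F x"]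
    by (simp add: alpha1_def act_left_add)
  have a2: "act alpha2 n v = scale (1 / csqrt (-2)) (E n v - F n v)" for n v
    using act_left_scale[of "1 / csqrt (-2)" "\<lambda>x. sl2_vec sl2_E x - sl2_vec sl2_F x"]
    by (simp add: alpha2_def act_left_diff)
  have a3: "act alpha3 n v = scale (1 / csqrt 2) (H n v)" for n v
    using act_left_scale[of "1 / csqrt 2" "sl2_vec sl2_H"] by (simp add: alpha3_def)
  \<comment> \<open>Each root enters only through its square, whichever branch \<open>csqrt\<close>
    takes.\<close>
  have c: "csqrt 2 * csqrt 2 = 2" "csqrt (-2) * csqrt (-2) = -2"
    by (simp_all only: power2_csqrt flip: power2_eq_square)
  have r: "1 / csqrt 2 * (1 / csqrt 2) = 1 / 2" "1 / csqrt (-2) * (1 / csqrt (-2)) = - 1 / 2"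
    by (simp_all only: times_divide_times_eq c) auto
  have "\<omega> = scale (1/4) (act alpha1 (-1) (act alpha1 (-1) vac) + act alpha2 (-1) (act alpha2 (-1) vac)
      + act alpha3 (-1) (act alpha3 (-1) vac))"
    by (simp only: sugawara_def q_scale q_add sq) simp
  also have "act alpha1 (-1) (act alpha1 (-1) vac) =
      scale (1/2) (E (-1) (E (-1) vac) + E (-1) (F (-1) vac) + F (-1) (E (-1) vac) + F (-1) (F (-1) vac))"
    by (simp only: a1 act_linear scale_right_distrib scale_scale r add_ac)
  also have "act alpha2 (-1) (act alpha2 (-1) vac) =
      scale (-1/2) (E (-1) (E (-1) vac) - E (-1) (F (-1) vac) - F (-1) (E (-1) vac) + F (-1) (F (-1) vac))"
    by (simp only: a2 act_linear scale_right_distrib scale_right_diff_distrib scale_scale r) (simp add: algebra_simps)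
  also have "act alpha3 (-1) (act alpha3 (-1) vac) = scale (1/2) (H (-1) (H (-1) vac))"
    by (simp only: a3 act_linear scale_scale r)
  finally have "\<omega> = scale (1/4) (scale (1/2 + 1/2) (E (-1) (F (-1) vac)) + scale (1/2 + 1/2) (F (-1) (E (-1) vac))
    + scale (1/2) (H (-1) (H (-1) vac)))"
    by (simp only: scale_left_distrib) (simp add: algebra_simps)
  then show ?thesis by (simp add: \<Omega>_def)
qed

lemma scale_2: "scale 2 v = v + v"
  using scale_left_distrib[of 1 1 v] by simp

lemma scale_half_add:
  "scale (1/2) v + scale (1/2) v = v" "scale (1/2) v + (scale (1/2) v + w) = v + w"
  by (simp_all flip: scale_left_distrib add.assoc)

text \<open>The value 0 at \<open>j = 0\<close> is the invariance of the Casimir vector. The 4 at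
  \<open>j = 1\<close> is twice the sum of the level 0 and the dual Coxeter number 2.\<close>

lemma act_Omega:
  assumes "j \<ge> 0"
  shows "act (sl2_vec x) j \<Omega> = (if j = 1 then scale 4 (act (sl2_vec x) (-1) vac) else 0)"
proof -
  consider "j = 0" | "j = 1" | "j > 1" using assms by linarith
  then show ?thesis
  proof cases
    case 1
    then show ?thesis
      by (cases x) (simp_all add: \<Omega>_def act_linear act_sort act_vac algebra_simps)
  next
    case 2
    have four: "scale 4 v = scale 2 v + scale 2 v" for v
      using scale_left_distrib[of 2 2 v] by simp
    from 2 show ?thesis
      by (cases x) (simp_all add: \<Omega>_def act_linear act_sort act_vac four, simp_all add: scale_2 scale_half_add algebra_simps)
  next
    case 3
    then show ?thesis
      by (cases x) (simp_all add: \<Omega>_def act_linear act_sort act_vac)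
  qed
qed

text \<open>By \<open>act_Omega\<close> only \<open>j = 1\<close> contributes to the commutator
  formula. With L(n) the mode n + 1 of \<open>\<omega>\<close>, this is [L(n), x(m)] = -m
  x(m+n).\<close>

lemma commute_sugawara:
  "act (sl2_vec x) m (Y \<omega> n w) = Y \<omega> n (act (sl2_vec x) m w) + scale (of_int m) (act (sl2_vec x) (m + n - 1) w)"
proof -
  have j: "act (sl2_vec x) (int j) \<omega> = (if j = 1 then act (sl2_vec x) (-1) vac else 0)" for j
    using act_Omega[of "int j" x] by (simp add: sugawara_eq act_linear)
  have "act (sl2_vec x) m (Y \<omega> n w) - Y \<omega> n (act (sl2_vec x) m w) =
    Sum_any (\<lambda>j::nat. scale (of_int m gchoose j) (Y (act (sl2_vec x) (int j) \<omega>) (m + n - int j) w))"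
    using commutator_formula[of "act (sl2_vec x) (-1) vac" \<omega> w m n] by (simp add: Y_act_vac)
  also have "\<dots> = scale (of_int m) (act (sl2_vec x) (m + n - 1) w)"
    by (subst Sum_any_single[where i = 1]) (simp_all add: j j[of 1, simplified] mode_zero_left Y_act_vac)
  finally show ?thesis by (simp add: algebra_simps)
qed

lemma sugawara_act:
  "Y \<omega> n (act (sl2_vec x) m w) = act (sl2_vec x) m (Y \<omega> n w) - scale (of_int m) (act (sl2_vec x) (m + n - 1) w)"
  by (simp add: commute_sugawara)

section \<open>The Sugawara vector is conformal\<close>

text \<open>Words in the generators span the tensor algebra, and words containing K map to 0, so the
  currents generate the module from the vacuum.\<close>

lemma generated_induct [case_names vac act add scale]:
  assumes vac: "P vac"
    and act: "\<And>x n v. P v \<Longrightarrow> P (act (sl2_vec x) n v)"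
    and add: "\<And>v w. P v \<Longrightarrow> P w \<Longrightarrow> P (v + w)"
    and scale: "\<And>c v. P v \<Longrightarrow> P (scale c v)"
  shows "P v"
proof -
  have zero: "P 0" using scale[OF vac, of 0] by simp
  have word: "P (q (Poly_Mapping.single xs 1))" for xs
  proof (induction xs)
    case Nil
    show ?case using vac by (simp add: zero_list_def flip: single_one)
  next
    case (Cons g xs)
    have s: "Poly_Mapping.single (g # xs) 1 = gen g * Poly_Mapping.single xs 1"
      by (simp add: gen_def mult_single plus_list_def)
    show ?case
    proof (cases g)
      case (Cur x n)
      then show ?thesis using act[OF Cons.IH, of x n] by (simp add: s[unfolded Cur] act_q current_vec)
    next
      case Cen
      then show ?thesis using q_gen_Cen[of 1] zero by (simp add: s[unfolded Cen])
    qed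
  qed
  have "P (q u)" for u
  proof (induction u rule: poly_mapping_single_add_induct)
    case zero
    then show ?case using \<open>P 0\<close> by (simp add: q_zero)
  next
    case (single_add k c f)
    have "Poly_Mapping.single k c = scalar c * Poly_Mapping.single k 1"
      by (simp add: scalar_def mult_single plus_list_def)
    then show ?case using add[OF scale[OF word[of k], of c] single_add.IH]
      by (simp add: q_add q_scale)
  qed
  then show ?thesis using q_surj by (metis surjD)
qed

lemma Y_sugawara_linear:
  "Y \<omega> n (v + w) = Y \<omega> n v + Y \<omega> n w"
  "Y \<omega> n (scale c v) = scale c (Y \<omega> n v)"
  by (simp_all add: mode_add_right mode_scale_right)

lemma sugawara_vac: "n \<ge> 0 \<Longrightarrow> Y \<omega> n vac = 0"
  by (simp add: creation)

text \<open>Both operators kill the vacuum and have the same commutators with all x(n), hence agree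
  on everything the currents generate. So L(-1) is translation.\<close>

lemma sugawara_translation: "Y \<omega> 0 u = Y u (-2) vac"
proof (induction u rule: generated_induct)
  case vac
  then show ?case by (simp add: sugawara_vac vacuum)
next
  case (act x n v)
  have "Y (act (sl2_vec x) n v) (-2) vac
      = act (sl2_vec x) n (Y v (-2) vac) - scale (of_int n) (act (sl2_vec x) (n - 1) v)"
    using translation_derivation[of "act (sl2_vec x) (-1) vac" v n] by (simp add: Y_act_vac)
  then show ?case using act by (simp add: sugawara_act)
next
  case (add v w)
  then show ?case by (simp add: Y_sugawara_linear mode_add_left)
next
  case (scale c v)
  then show ?case by (simp add: Y_sugawara_linear mode_scale_left)
qed

text \<open>These products determine the commutators of the modes of \<open>\<omega>\<close>. The
  vanishing for \<open>n = 3\<close> says that the central charge 3l/(l + 2) is 0 at level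
  0.\<close>

lemma sugawara_sugawara:
  "Y \<omega> 1 \<omega> = scale 2 \<omega>"
  "n \<ge> 2 \<Longrightarrow> Y \<omega> n \<omega> = 0"
proof -
  have "Y \<omega> 1 \<Omega> = scale 2 \<Omega>"
    by (simp add: \<Omega>_def Y_sugawara_linear sugawara_act act_linear sugawara_vac scale_2 scale_half_add algebra_simps)
  then have "Y \<omega> 1 (scale (1/4) \<Omega>) = scale 2 (scale (1/4) \<Omega>)"
    by (simp add: Y_sugawara_linear)
  then show "Y \<omega> 1 \<omega> = scale 2 \<omega>"
    by (simp only: sugawara_eq[symmetric])
  assume n: "n \<ge> 2"
  then consider "n = 2" | "n = 3" | "n \<ge> 4" by linarith
  then have "Y \<omega> n \<Omega> = 0"
  proof cases
    case 1
    then show ?thesis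
      by (simp add: \<Omega>_def Y_sugawara_linear sugawara_act act_linear sugawara_vac act_sort act_vac algebra_simps)
  next
    case 2
    then show ?thesis
      by (simp add: \<Omega>_def Y_sugawara_linear sugawara_act act_linear sugawara_vac act_sort act_vac algebra_simps)
  next
    case 3
    then show ?thesis
      by (simp add: \<Omega>_def Y_sugawara_linear sugawara_act act_linear sugawara_vac act_sort act_vac algebra_simps)
  qed
  then show "Y \<omega> n \<omega> = 0"
    using Y_sugawara_linear(2)[of n "1/4" \<Omega>] by (simp flip: sugawara_eq)
qed

lemma sugawara_virasoro:
  "Y \<omega> (m + 1) (Y \<omega> (n + 1) v) - Y \<omega> (n + 1) (Y \<omega> (m + 1) v) = scale (of_int (m - n)) (Y \<omega> (m + n + 1) v)"
proof -
  let ?f = "\<lambda>j::nat. scale (of_int (m + 1) gchoose j) (Y (Y \<omega> (int j) \<omega>) (m + n + 2 - int j) v)"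
  have "Y \<omega> (m + 1) (Y \<omega> (n + 1) v) - Y \<omega> (n + 1) (Y \<omega> (m + 1) v) = Sum_any ?f"
    using commutator_formula[of \<omega> \<omega> v "m + 1" "n + 1"] by (simp add: algebra_simps)
  also have "\<dots> = sum ?f {0, 1}"
  proof (rule Sum_any.expand_superset)
    show "{j. ?f j \<noteq> 0} \<subseteq> {0, 1}"
    proof (rule subsetI, rule ccontr)
      fix j assume "j \<in> {j. ?f j \<noteq> 0}" "j \<notin> {0, 1}"
      moreover from this have "int j \<ge> 2" by auto
      then have "?f j = 0" by (simp add: sugawara_sugawara mode_zero_left)
      ultimately show False by simp
    qed
  qed simp
  \<comment> \<open>The term \<open>j = 0\<close> contributes -(m + n + 2) through the translate of
    \<open>\<omega>\<close>, and \<open>j = 1\<close> contributes 2(m + 1).\<close>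
  also have "\<dots> = scale (of_int (m - n)) (Y \<omega> (m + n + 1) v)"
    by (simp add: sugawara_sugawara sugawara_translation translation_mode mode_scale_left
        flip: scale_left_distrib) (simp add: algebra_simps)
  finally show ?thesis .
qed

lemma sugawara_derivative: "Y (Y \<omega> 0 u) n v = scale (- of_int n) (Y u (n - 1) v)"
  by (simp add: sugawara_translation translation_mode)

section \<open>Spanning monomials and the weight grading\<close>

lemma act_expand:
  "act a n v = scale (a sl2_H) (H n v) + (scale (a sl2_E) (E n v) + scale (a sl2_F) (F n v))"
proof -
  have "a = (\<lambda>x. a sl2_H * sl2_vec sl2_H x + (a sl2_E * sl2_vec sl2_E x + a sl2_F * sl2_vec sl2_F x))"
    by (rule ext, case_tac x) (simp_all add: sl2_vec_def)
  then have "act a n v = act (\<lambda>x. a sl2_H * sl2_vec sl2_H x + (a sl2_E * sl2_vec sl2_E x + a sl2_F * sl2_vec sl2_F x)) n v"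
    by simp
  also have "\<dots> = scale (a sl2_H) (H n v) + (scale (a sl2_E) (E n v) + scale (a sl2_F) (F n v))"
    by (simp only: act_left_add act_left_scale)
  finally show ?thesis .
qed

text \<open>The pair (x, k) encodes x(-1-k), so every mode is negative. The factors stand in any
  order: a spanning family, not a PBW basis.\<close>

primrec monomial :: "(sl2_basis \<times> nat) list \<Rightarrow> 'v" where
  "monomial [] = vac"
| "monomial (p # ps) = act (sl2_vec (fst p)) (- 1 - int (snd p)) (monomial ps)"

primrec wt :: "(sl2_basis \<times> nat) list \<Rightarrow> nat" where
  "wt [] = 0"
| "wt (p # ps) = Suc (snd p) + wt ps"

lemma sugawara_monomial: "Y \<omega> 1 (monomial ps) = scale (of_nat (wt ps)) (monomial ps)"
proof (induction ps)
  case Nil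
  then show ?case by (simp add: sugawara_vac)
next
  case (Cons p ps)
  define k where "k = - 1 - int (snd p)"
  then have "of_nat (wt (p # ps)) = (of_nat (wt ps) - of_int k :: complex)" by simp
  moreover have "Y \<omega> 1 (act (sl2_vec (fst p)) k (monomial ps)) =
      scale (of_nat (wt ps) - of_int k) (act (sl2_vec (fst p)) k (monomial ps))"
    by (simp add: sugawara_act act_linear Cons scale_left_diff_distrib)
  ultimately show ?case by (simp only: monomial.simps k_def)
qed

lemma act_span:
  assumes "\<And>w. w \<in> B \<Longrightarrow> act a n w \<in> span C" and "v \<in> span B"
  shows "act a n v \<in> span C"
  using assms(2)
  by (induction rule: span_induct_alt)
    (auto simp: act_linear span_zero intro!: span_add span_scale assms(1))

text \<open>A nonnegative mode is commuted inward until it meets the vacuum. Each commutator is a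
  single current on a shorter monomial, whence the induction for all \<open>x\<close> and
  \<open>n\<close>.\<close>

lemma act_mono_in_span: "act (sl2_vec x) n (monomial ps) \<in> span (range monomial)"
proof (induction ps arbitrary: x n)
  case Nil
  show ?case
  proof (cases "n \<ge> 0")
    case True
    then show ?thesis by (simp add: act_vac span_zero)
  next
    case False
    then have "act (sl2_vec x) n (monomial []) = monomial [(x, nat (- 1 - n))]" by simp
    then show ?thesis by (metis rangeI span_base)
  qed
next
  case (Cons p ps)
  have neg: "act (sl2_vec x) n (monomial qs) \<in> span (range monomial)" if "n < 0" for x n qs
  proof -
    from that have "act (sl2_vec x) n (monomial qs) = monomial ((x, nat (- 1 - n)) # qs)" by simp
    then show ?thesis by (metis rangeI span_base)
  qed
  have "act (sl2_vec (fst p)) (- 1 - int (snd p)) (act (sl2_vec x) n (monomial ps)) \<in> span (range monomial)"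
    by (rule act_span[OF _ Cons.IH]) (auto simp: neg)
  moreover have "act (sl2_bracket x (fst p)) k (monomial ps) \<in> span (range monomial)" for k
    by (subst act_expand) (intro span_add span_scale Cons.IH)
  ultimately show ?case
    by (simp add: act_commute[of x n] span_add)
qed

lemma span_range_mono: "v \<in> span (range monomial)"
proof (induction v rule: generated_induct)
  case vac
  show ?case using span_base[OF rangeI, of monomial "[]"] by simp
next
  case (act x n v)
  then show ?case by (rule act_span[rotated]) (auto simp: act_mono_in_span)
qed (simp_all add: span_add span_scale)

text \<open>Subtracting \<open>l\<close> times the relation from its image under L(0) removes
  \<open>f l\<close> and multiplies the other vectors by nonzero factors.\<close>

lemma eigenvectors_independent:
  assumes "finite W" and "\<And>k::nat. k \<in> W \<Longrightarrow> Y \<omega> 1 (f k) = scale (of_nat k) (f k)"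
    and "sum f W = 0" and "k \<in> W"
  shows "f k = 0"
  using assms
proof (induction W arbitrary: f k rule: finite_induct)
  case empty
  then show ?case by simp
next
  case (insert l W)
  let ?g = "\<lambda>j. scale (of_nat j - of_nat l) (f j)"
  have Ysum: "Y \<omega> 1 (sum h W) = (\<Sum>j\<in>W. Y \<omega> 1 (h j))" for h
    using \<open>finite W\<close> by (induction W rule: finite_induct) (simp_all add: Y_sugawara_linear mode_zero_right)
  have s: "f l + sum f W = 0" using insert by simp
  then have "Y \<omega> 1 (f l + sum f W) = 0" by (simp add: mode_zero_right)
  then have "scale (of_nat l) (f l) + (\<Sum>j\<in>W. scale (of_nat j) (f j)) = 0"
    using insert.prems(1) by (simp add: Y_sugawara_linear Ysum)
  moreover have "scale (of_nat l) (f l + sum f W) = 0" using s by simp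
  ultimately have "sum ?g W = 0"
    by (simp add: scale_right_distrib scale_sum_right scale_left_diff_distrib sum_subtractf)
      (metis add_left_imp_eq)
  then have "?g j = 0" if "j \<in> W" for j
    by (rule insert.IH[rotated]) (use insert.prems(1) that in \<open>auto simp: Y_sugawara_linear mult.commute\<close>)
  then have z: "f j = 0" if "j \<in> W" for j
    using that \<open>l \<notin> W\<close> by (auto simp: scale_eq_0_iff)
  then have "f l = 0" using s by simp
  with z insert.prems show ?case by auto
qed

text \<open>Grouping monomials by weight splits \<open>v\<close> into L(0)-eigenvectors;
  independence kills each component of weight other than \<open>k\<close>.\<close>

lemma eigenvector_in_span:
  assumes v: "Y \<omega> 1 v = scale (of_int k) v"
  shows "v \<in> span (monomial ` {ps. int (wt ps) = k})"
proof -
  let ?B = "\<lambda>k. span (monomial ` {ps. int (wt ps) = k})"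
  obtain t r where t: "finite t" "t \<subseteq> range monomial" and vt: "v = (\<Sum>a\<in>t. scale (r a) a)"
    using span_range_mono[of v] unfolding span_explicit by auto
  \<comment> \<open>A vector may come from several words, so one representing word is fixed for
    each.\<close>
  define g where "g a = wt (SOME ps. a = monomial ps)" for a
  have g: "a \<in> monomial ` {ps. int (wt ps) = int (g a)}" if "a \<in> t" for a
  proof -
    from that t have "\<exists>ps. a = monomial ps" by auto
    then have "a = monomial (SOME ps. a = monomial ps)" by (rule someI_ex)
    then show ?thesis by (auto simp: g_def)
  qed
  define f where "f j = (\<Sum>a\<in>{a\<in>t. g a = j}. scale (r a) a)" for j
  have vf: "v = sum f (g ` t)"
    unfolding vt f_def by (rule sum.image_gen[OF t(1)])
  have fB: "f j \<in> ?B (int j)" for j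
    unfolding f_def
  proof (rule span_sum)
    fix a assume "a \<in> {a \<in> t. g a = j}"
    then have "a \<in> ?B (int j)" using g[of a] by (auto intro: span_base)
    then show "scale (r a) a \<in> ?B (int j)" by (rule span_scale)
  qed
  have BE: "Y \<omega> 1 w = scale (of_nat j) w" if "w \<in> ?B (int j)" for w j
    using that
    by (induction rule: span_induct_alt)
      (auto simp: Y_sugawara_linear mode_zero_right scale_right_distrib mult.commute sugawara_monomial)
  have Ysum: "Y \<omega> 1 (sum f W) = (\<Sum>j\<in>W. Y \<omega> 1 (f j))" if "finite W" for W
    using that by (induction W rule: finite_induct) (simp_all add: Y_sugawara_linear mode_zero_right)
  have "(\<Sum>j\<in>g ` t. scale (of_nat j - of_int k) (f j)) = Y \<omega> 1 v - scale (of_int k) v"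
    using t(1) by (simp add: vf Ysum BE[OF fB] scale_left_diff_distrib sum_subtractf scale_sum_right)
  then have "(\<Sum>j\<in>g ` t. scale (of_nat j - of_int k) (f j)) = 0" using v by simp
  then have "scale (of_nat j - of_int k) (f j) = 0" if "j \<in> g ` t" for j
    by (rule eigenvectors_independent[rotated 2])
      (use that t(1) in \<open>auto simp: Y_sugawara_linear BE[OF fB] mult.commute\<close>)
  then have "int j = k \<or> f j = 0" if "j \<in> g ` t" for j
    using that by (metis of_int_of_nat_eq of_int_eq_iff right_minus_eq scale_eq_0_iff)
  then have "f j \<in> ?B k" if "j \<in> g ` t" for j
    using that fB[of j] span_zero by metis
  then show ?thesis unfolding vf by (rule span_sum)
qed

lemma finite_wt: "finite {ps. int (wt ps) = k}"
proof -
  have "length ps \<le> wt ps" for ps by (induction ps) auto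
  moreover have "p \<in> set ps \<Longrightarrow> snd p \<le> wt ps" for p ps by (induction ps) auto
  moreover have "x \<in> {sl2_H, sl2_E, sl2_F}" for x by (cases x) auto
  ultimately have "{ps. int (wt ps) = k} \<subseteq>
      {ps. set ps \<subseteq> {sl2_H, sl2_E, sl2_F} \<times> {..nat k} \<and> length ps \<le> nat k}"
    by fastforce
  then show ?thesis
    by (rule finite_subset) (rule finite_lists_length_le, simp)
qed

lemma sugawara_vertex_operator_algebra: "vertex_operator_algebra scale UNIV Y vac \<omega>"
proof unfold_locales
  show "\<exists>c::complex. \<forall>m n. \<forall>v\<in>UNIV.
      Y \<omega> (m + 1) (Y \<omega> (n + 1) v) - Y \<omega> (n + 1) (Y \<omega> (m + 1) v) =
        scale (of_int (m - n)) (Y \<omega> (m + n + 1) v)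
        + (if m + n = 0 then scale ((of_int m ^ 3 - of_int m) / 12 * c) v else 0)"
    by (rule exI[of _ 0]) (simp add: sugawara_virasoro)
  show "Y (Y \<omega> 0 u) n v = scale (- of_int n) (Y u (n - 1) v)" for u v n
    by (rule sugawara_derivative)
  have "monomial ps \<in> weight_space \<omega> (int (wt ps))" for ps
    by (simp add: weight_space_def sugawara_monomial)
  then have "range monomial \<subseteq> (\<Union>k. weight_space \<omega> k)" by blast
  then show "UNIV = span (\<Union>k. weight_space \<omega> k)"
    using span_mono span_range_mono by blast
  show "\<exists>B. finite B \<and> weight_space \<omega> k \<subseteq> span B" for k
    using finite_wt[of k] eigenvector_in_span[of _ k]
    by (intro exI[of _ "monomial ` {ps. int (wt ps) = k}"]) (auto simp: weight_space_def)
  have "weight_space \<omega> k = {0}" if "k < 0" for k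
  proof -
    have "{ps. int (wt ps) = k} = {}" using that by auto
    then show ?thesis
      using eigenvector_in_span[of _ k] by (auto simp: weight_space_def mode_zero_right)
  qed
  then show "\<exists>N::int. \<forall>k<N. weight_space \<omega> k = {0}" by blast
qed simp

section \<open>The semi-conformal vectors 0 and \<open>\<omega>\<close>\<close>

lemma zero_in_Sc: "0 \<in> Sc scale UNIV Y vac \<omega>"
proof -
  \<comment> \<open>The line through the vacuum has weight 0 only, and all modes of
    \<open>\<omega>\<close> of index at least 0 kill it, in agreement with the modes of 0.\<close>
  define U where "U = range (\<lambda>c. scale c vac)"
  have modes: "Y (scale c vac) n (scale d vac) = scale (c * d * of_bool (n = -1)) vac" for c d n
    by (simp add: mode_scale_left mode_scale_right vacuum)
  have mem: "scale c vac \<in> U" for c by (auto simp: U_def)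
  have subspace: "subspace U"
    unfolding U_def
    by (rule subspaceI) (auto simp: image_iff simp flip: scale_left_distrib intro: exI[of _ 0])
  have sub: "vertex_subalgebra scale UNIV Y vac U"
    unfolding vertex_subalgebra_def
  proof (intro conjI ballI allI)
    show "vac \<in> U" using mem[of 1] by simp
    show "Y u n v \<in> U" if "u \<in> U" "v \<in> U" for u v n
      using that mem by (auto simp: U_def modes)
  qed (use subspace in auto)
  interpret U: vertex_algebra scale U Y vac
    by (rule vertex_algebra_subalgebra[OF sub])
  have w: "U.weight_space 0 k = {0}" if "k \<noteq> 0" for k
    using that subspace_0[OF subspace] by (auto simp: U.weight_space_def mode_zero_left)
  have "vertex_operator_algebra scale U Y vac 0"
  proof unfold_locales
    show "0 \<in> U" using subspace_0[OF subspace] .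
    show "\<exists>c::complex. \<forall>m n. \<forall>v\<in>U.
      Y 0 (m + 1) (Y 0 (n + 1) v) - Y 0 (n + 1) (Y 0 (m + 1) v) =
        scale (of_int (m - n)) (Y 0 (m + n + 1) v)
        + (if m + n = 0 then scale ((of_int m ^ 3 - of_int m) / 12 * c) v else 0)"
      by (rule exI[of _ 0]) (simp add: mode_zero_left)
    show "Y (Y 0 0 u) n v = scale (- of_int n) (Y u (n - 1) v)" if "u \<in> U" "v \<in> U" for u v n
      using that by (auto simp: U_def modes mode_zero_left)
    show "U = span (\<Union>k. U.weight_space 0 k)"
    proof -
      have "(\<Union>k. U.weight_space 0 k) = U"
        by (auto simp: U.weight_space_def mode_zero_left intro: exI[of _ 0])
      then show ?thesis by (simp only: span_eq_iff[THEN iffD2, OF subspace])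
    qed
    show "\<exists>B. finite B \<and> U.weight_space 0 k \<subseteq> span B" for k
    proof (rule exI[of _ "{vac}"], intro conjI)
      have "U.weight_space 0 k \<subseteq> U" by (auto simp: U.weight_space_def)
      also have "U \<subseteq> span {vac}" by (auto simp: U_def intro: span_scale span_base)
      finally show "U.weight_space 0 k \<subseteq> span {vac}" .
    qed simp
    show "\<exists>N::int. \<forall>k<N. U.weight_space 0 k = {0}" using w by (intro exI[of _ 0]) auto
  qed
  moreover have "Y 0 n u = Y \<omega> n u" if "n \<ge> 0" "u \<in> U" for n u
    using that by (auto simp: U_def mode_zero_left Y_sugawara_linear sugawara_vac)
  ultimately show ?thesis using sub by (auto simp: Sc_def)
qed

lemma sugawara_in_Sc: "\<omega> \<in> Sc scale UNIV Y vac \<omega>"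
proof -
  have "vertex_subalgebra scale UNIV Y vac UNIV" by (simp add: vertex_subalgebra_def)
  then show ?thesis using sugawara_vertex_operator_algebra unfolding Sc_def by blast
qed

section \<open>Vectors of weight two\<close>

text \<open>The weight-two vectors and, in \<open>vec1\<close>, the weight-one vectors in PBW coordinates.
  No linear independence is claimed.\<close>

definition vec :: "complex \<Rightarrow> complex \<Rightarrow> complex \<Rightarrow> complex \<Rightarrow> complex \<Rightarrow> complex \<Rightarrow> complex \<Rightarrow> complex \<Rightarrow> complex \<Rightarrow> 'v"
  where "vec a b c d g k x y z =
    scale a (E (-1) (E (-1) vac)) + (scale b (E (-1) (H (-1) vac)) + (scale c (E (-1) (F (-1) vac))
    + (scale d (H (-1) (H (-1) vac)) + (scale g (H (-1) (F (-1) vac)) + (scale k (F (-1) (F (-1) vac))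
    + (scale x (E (-2) vac) + (scale y (H (-2) vac) + scale z (F (-2) vac))))))))"

definition vec1 :: "complex \<Rightarrow> complex \<Rightarrow> complex \<Rightarrow> 'v" where
  "vec1 x y z = scale x (E (-1) vac) + (scale y (H (-1) vac) + scale z (F (-1) vac))"

lemma vec_arith:
  "vec a b c d g k x y z + vec a' b' c' d' g' k' x' y' z' =
    vec (a + a') (b + b') (c + c') (d + d') (g + g') (k + k') (x + x') (y + y') (z + z')"
  "scale t (vec a b c d g k x y z) =
    vec (t * a) (t * b) (t * c) (t * d) (t * g) (t * k) (t * x) (t * y) (t * z)"
  "vec a b c d g k x y z - vec a' b' c' d' g' k' x' y' z' =
    vec (a - a') (b - b') (c - c') (d - d') (g - g') (k - k') (x - x') (y - y') (z - z')"
  "- vec a b c d g k x y z = vec (- a) (- b) (- c) (- d) (- g) (- k) (- x) (- y) (- z)"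
  by (simp_all add: vec_def algebra_simps)

lemma vec1_arith:
  "vec1 x y z + vec1 x' y' z' = vec1 (x + x') (y + y') (z + z')"
  "scale t (vec1 x y z) = vec1 (t * x) (t * y) (t * z)"
  "vec1 x y z - vec1 x' y' z' = vec1 (x - x') (y - y') (z - z')"
  "- vec1 x y z = vec1 (- x) (- y) (- z)"
  by (simp_all add: vec1_def algebra_simps)

lemma generators_vec1:
  "E (-1) vac = vec1 1 0 0" "H (-1) vac = vec1 0 1 0" "F (-1) vac = vec1 0 0 1"
  by (simp_all add: vec1_def)

lemma products_vec:
  "E (-1) (E (-1) vac) = vec 1 0 0 0 0 0 0 0 0"
  "E (-1) (H (-1) vac) = vec 0 1 0 0 0 0 0 0 0"
  "E (-1) (F (-1) vac) = vec 0 0 1 0 0 0 0 0 0"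
  "H (-1) (E (-1) vac) = vec 0 1 0 0 0 0 2 0 0"
  "H (-1) (H (-1) vac) = vec 0 0 0 1 0 0 0 0 0"
  "H (-1) (F (-1) vac) = vec 0 0 0 0 1 0 0 0 0"
  "F (-1) (E (-1) vac) = vec 0 0 1 0 0 0 0 (-1) 0"
  "F (-1) (H (-1) vac) = vec 0 0 0 0 1 0 0 0 2"
  "F (-1) (F (-1) vac) = vec 0 0 0 0 0 1 0 0 0"
  "E (-2) vac = vec 0 0 0 0 0 0 1 0 0"
  "H (-2) vac = vec 0 0 0 0 0 0 0 1 0"
  "F (-2) vac = vec 0 0 0 0 0 0 0 0 1"
  using act_commute_basis(1)[of "-1" "-1" vac] act_commute_basis(6)[of "-1" "-1" vac]
    act_commute_basis(4)[of "-1" "-1" vac]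
  by (simp_all add: vec_def)

lemma act_minus_1_vec1:
  "E (-1) (vec1 x y z) = vec x y z 0 0 0 0 0 0"
  "H (-1) (vec1 x y z) = vec 0 x 0 y z 0 (2 * x) 0 0"
  "F (-1) (vec1 x y z) = vec 0 0 x 0 y z 0 (- x) (2 * y)"
  by (simp_all add: vec1_def act_linear products_vec vec_arith mult.commute)

lemma act_0_vec:
  "E 0 (vec a b c d g k x y z) = vec (-2 * b) (c - 4 * d) (-2 * g) g (2 * k) 0 (-2 * y - 4 * d) z (2 * k)"
  "H 0 (vec a b c d g k x y z) = vec (4 * a) (2 * b) 0 0 (-2 * g) (-4 * k) (2 * x) 0 (-2 * z)"
  "F 0 (vec a b c d g k x y z) = vec 0 (-2 * a) (2 * b) (- b) (4 * d - c) (2 * g) (-2 * a) (- x) (4 * d + 2 * y)"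
  unfolding vec_def[of a b c d g k x y z]
  by (simp_all add: act_linear act_sort act_vac) (simp_all add: products_vec vec_arith algebra_simps)

lemma act_1_vec:
  "E 1 (vec a b c d g k x y z) = vec1 (4 * d - 2 * y) (z - 2 * g) (-2 * k)"
  "H 1 (vec a b c d g k x y z) = vec1 (2 * x - 4 * b) (2 * c) (-2 * z)"
  "F 1 (vec a b c d g k x y z) = vec1 (-2 * a) (- x) (2 * c + 4 * d + 2 * y)"
  unfolding vec_def[of a b c d g k x y z]
  by (simp_all add: act_linear act_sort act_vac) (simp_all add: generators_vec1 vec1_arith algebra_simps)

lemma act_ge_2_vec:
  "n \<ge> 2 \<Longrightarrow> act (sl2_vec u) n (vec a b c d g k x y z) = 0"
  by (cases u) (simp_all add: vec_def act_linear act_sort act_vac)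

text \<open>This is L(1). Its three coefficients vanish exactly when the coordinates have the
  symmetric shape \<open>quad\<close>.\<close>

lemma sugawara_2_vec:
  "Y \<omega> 2 (vec a b c d g k x y z) = vec1 (2 * x - 2 * b) (c + 2 * y) (2 * z - 2 * g)"
  unfolding vec_def
  by (simp add: Y_sugawara_linear sugawara_act sugawara_vac act_linear act_sort act_vac)
    (simp add: generators_vec1 vec1_arith algebra_simps)

lemma sugawara_0_vec1: "Y \<omega> 0 (vec1 x y z) = vec 0 0 0 0 0 0 x y z"
  by (simp add: vec1_def vec_def Y_sugawara_linear sugawara_act sugawara_vac act_linear)

text \<open>Symmetric quadratic vectors: the coordinates of \<open>h(-2)1\<close> etc. are those which turn
  \<open>e(-1)f(-1)1\<close> into \<open>(e(-1)f(-1) + f(-1)e(-1))1/2\<close> etc.\<close>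

definition quad :: "complex \<Rightarrow> complex \<Rightarrow> complex \<Rightarrow> complex \<Rightarrow> complex \<Rightarrow> complex \<Rightarrow> 'v" where
  "quad a b c d g k = vec a b c d g k b (- c / 2) g"

lemma act_0_quad:
  "E 0 (quad a b c d g k) = quad (-2 * b) (c - 4 * d) (-2 * g) g (2 * k) 0"
  "F 0 (quad a b c d g k) = quad 0 (-2 * a) (2 * b) (- b) (4 * d - c) (2 * g)"
  by (simp_all add: quad_def act_0_vec)

lemma quad_arith:
  "quad a b c d g k + quad a' b' c' d' g' k' = quad (a + a') (b + b') (c + c') (d + d') (g + g') (k + k')"
  "scale t (quad a b c d g k) = quad (t * a) (t * b) (t * c) (t * d) (t * g) (t * k)"
  "quad a b c d g k - quad a' b' c' d' g' k' = quad (a - a') (b - b') (c - c') (d - d') (g - g') (k - k')"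
  by (simp_all add: quad_def vec_arith field_simps)

lemma Omega_quad: "\<Omega> = quad 0 0 2 (1/2) 0 0"
  by (simp add: \<Omega>_def quad_def products_vec vec_arith)

text \<open>The coordinate \<open>c - 4 d\<close> vanishes exactly on the multiples of \<open>\<Omega>\<close>; the other five coordinates
  are those of the five-dimensional irreducible \<open>sl\<^sub>2\<close>-module generated by \<open>e(-1)e(-1)1\<close>.\<close>

lemma quad_eq_0:
  assumes "quad a b c d g k = 0" and nz: "quad 1 0 0 0 0 0 \<noteq> 0"
  shows "a = 0" "b = 0" "c = 4 * d" "g = 0" "k = 0"
proof -
  have zero: "quad t 0 0 0 0 0 = 0 \<longleftrightarrow> t = 0" for t
    using quad_arith(2)[of t 1 0 0 0 0 0] nz by (metis mult_1_right mult_zero_right scale_eq_0_iff)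
  have E: "E 0 v = 0" if "v = 0" for v using that by (simp add: act_zero)
  \<comment> \<open>\<open>E 0\<close> raises weights: four applications leave only
    \<open>k\<close>, as the coefficient 24k of e(-1)e(-1)1. Fewer applications then give the other
    coordinates in turn.\<close>
  have k: "k = 0"
    using E[OF E[OF E[OF E[OF assms(1)]]]] nz by (simp add: act_0_quad zero)
  have g: "g = 0"
    using E[OF E[OF E[OF assms(1)]]] nz by (simp add: act_0_quad zero k)
  have c: "c = 4 * d"
    using E[OF E[OF assms(1)]] nz by (simp add: act_0_quad zero k g)
  have b: "b = 0"
    using E[OF assms(1)] nz by (simp add: act_0_quad zero k g c)
  have a: "a = 0"
  proof -
    \<comment> \<open>What remains is a e(-1)e(-1)1 plus a multiple of \<open>\<Omega>\<close>.
      \<open>F 0\<close> kills the multiple, and \<open>E 0\<close> brings the first term back with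
      factor 4.\<close>
    have "E 0 (F 0 (quad a b c d g k)) = 0" using assms(1) by (simp add: act_zero)
    then show ?thesis using nz by (simp add: act_0_quad zero k g c b)
  qed
  show "a = 0" "b = 0" "c = 4 * d" "g = 0" "k = 0" by fact+
qed

section \<open>Semi-conformal vectors\<close>

lemma monomial_weight_2:
  assumes "wt ps = 2"
  obtains a b c d g k x y z where "monomial ps = vec a b c d g k x y z"
proof (cases ps)
  case Nil
  with assms show ?thesis by simp
next
  case (Cons p qs)
  show ?thesis
  proof (cases qs)
    case Nil
    \<comment> \<open>A single factor of weight 2 is x(-2), encoded by the index 1.\<close>
    obtain u where p: "p = (u, 1)" using assms Cons Nil by (cases p) auto
    show ?thesis
      by (cases u) (use that in \<open>auto simp: Cons Nil p products_vec\<close>)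
  next
    case (Cons p' rs)
    have rs: "rs = []" using assms Cons \<open>ps = p # qs\<close> by (cases rs) auto
    obtain u where p: "p = (u, 0)" using assms Cons \<open>ps = p # qs\<close> by (cases p) auto
    obtain u' where p': "p' = (u', 0)" using assms Cons \<open>ps = p # qs\<close> by (cases p') auto
    show ?thesis
      by (cases u; cases u') (use that in \<open>auto simp: Cons \<open>ps = p # qs\<close> p p' rs products_vec\<close>)
  qed
qed

lemma weight_2_vec:
  assumes "Y \<omega> 1 v = scale 2 v"
  obtains a b c d g k x y z where "v = vec a b c d g k x y z"
proof -
  have "v \<in> span (monomial ` {ps. int (wt ps) = 2})"
    by (rule eigenvector_in_span) (simp add: assms)
  then have "\<exists>a b c d g k x y z. v = vec a b c d g k x y z"
  proof (induction rule: span_induct_alt)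
    case base
    have "0 = vec 0 0 0 0 0 0 0 0 0" by (simp add: vec_def)
    then show ?case by blast
  next
    case (step t m v)
    then obtain ps where "wt ps = 2" "m = monomial ps" by auto
    then obtain a b c d g k x y z where m: "m = vec a b c d g k x y z"
      using monomial_weight_2[of ps] by metis
    from step obtain a' b' c' d' g' k' x' y' z' where v: "v = vec a' b' c' d' g' k' x' y' z'"
      by blast
    show ?case unfolding m v vec_arith by blast
  qed
  with that show ?thesis by blast
qed

text \<open>The iterate formula at \<open>l = -1\<close>, where all coefficients are 1. Since modes
  from 2 on kill \<open>w\<close>, the normally ordered product reduces to three terms.\<close>

lemma quadratic_mode_1:
  assumes "\<And>x n. n \<ge> 2 \<Longrightarrow> act (sl2_vec x) n w = 0"
  shows "Y (act (sl2_vec x) (-1) (act (sl2_vec y) (-1) vac)) 1 w =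
    act (sl2_vec x) (-1) (act (sl2_vec y) 1 w) + act (sl2_vec y) 0 (act (sl2_vec x) 0 w)
    + act (sl2_vec y) (-1) (act (sl2_vec x) 1 w)"
proof -
  let ?f = "\<lambda>j::nat. act (sl2_vec x) (- 1 - int j) (act (sl2_vec y) (1 + int j) w)
    + act (sl2_vec y) (- int j) (act (sl2_vec x) (int j) w)"
  have sign: "(-1) ^ j * ((-1::complex) gchoose j) = 1" for j
    using gbinomial_minus[of "1::complex" j] by (simp add: power_mult_distrib[symmetric] flip: binomial_gbinomial)
  have "Y (act (sl2_vec x) (-1) (act (sl2_vec y) (-1) vac)) 1 w = Sum_any ?f"
    using iterate_formula[of "act (sl2_vec x) (-1) vac" "act (sl2_vec y) (-1) vac" w "-1" 1]
    by (simp add: Y_act_vac sign)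
  also have "\<dots> = sum ?f {0, 1}"
  proof (rule Sum_any.expand_superset)
    show "{j. ?f j \<noteq> 0} \<subseteq> {0, 1}"
    proof (rule subsetI, rule ccontr)
      fix j assume "j \<in> {j. ?f j \<noteq> 0}" "j \<notin> {0, 1}"
      moreover from this have "int j \<ge> 2" by auto
      then have "?f j = 0" by (simp add: assms act_zero)
      ultimately show False by simp
    qed
  qed simp
  also have "\<dots> = act (sl2_vec x) (-1) (act (sl2_vec y) 1 w) + act (sl2_vec y) 0 (act (sl2_vec x) 0 w)
    + act (sl2_vec y) (-1) (act (sl2_vec x) 1 w)"
    by (simp add: assms act_zero add.assoc)
  finally show ?thesis .
qed

lemma translate_mode_1: "Y (act (sl2_vec x) (-2) vac) 1 w = - act (sl2_vec x) 0 w"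
  using translation_mode[of "act (sl2_vec x) (-1) vac" w 1] by (simp add: Y_act_vac)

text \<open>Reduces equality of vectors to equality of coordinates; the converse would require
  linear independence.\<close>

lemma vec_cong:
  assumes "a = a'" "b = b'" "c = c'" "d = d'" "g = g'" "k = k'" "x = x'" "y = y'" "z = z'"
  shows "vec a b c d g k x y z = vec a' b' c' d' g' k' x' y' z'"
  using assms by simp

lemma quad_cong:
  assumes "a = a'" "b = b'" "c = c'" "d = d'" "g = g'" "k = k'"
  shows "quad a b c d g k = quad a' b' c' d' g' k'"
  using assms by simp

text \<open>Turns w_1 w = 2w into quadratic equations. The coordinates are combinations of the 2 by
  2 minors of the symmetric matrix with rows (2a, b, c), (b, 2d, g), (c, g, 2k).\<close>

lemma quad_square:
  "Y (quad a b c d g k) 1 (quad a b c d g k) =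
    quad (32 * a * d - 8 * b * b) (8 * b * c - 16 * a * g) (4 * c * c - 16 * a * k)
      (4 * a * k - 4 * b * g - c * c + 8 * c * d) (8 * c * g - 16 * b * k) (32 * d * k - 8 * g * g)"
proof -
  \<comment> \<open>With the name, the left factor can be expanded while the right one stays
    folded.\<close>
  define w where "w = vec a b c d g k b (- c / 2) g"
  have w: "act (sl2_vec x) n w = 0" if "n \<ge> 2" for x n
    using that by (simp add: w_def act_ge_2_vec)
  have mode_1: "Y (act (sl2_vec x) (-1) (act (sl2_vec y) (-1) vac)) 1 w =
    act (sl2_vec x) (-1) (act (sl2_vec y) 1 w) + act (sl2_vec y) 0 (act (sl2_vec x) 0 w)
    + act (sl2_vec y) (-1) (act (sl2_vec x) 1 w)" for x y
    by (rule quadratic_mode_1) (rule w)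
  have "Y w 1 w =
    scale a (Y (E (-1) (E (-1) vac)) 1 w) + (scale b (Y (E (-1) (H (-1) vac)) 1 w)
    + (scale c (Y (E (-1) (F (-1) vac)) 1 w)
    + (scale d (Y (H (-1) (H (-1) vac)) 1 w) + (scale g (Y (H (-1) (F (-1) vac)) 1 w)
    + (scale k (Y (F (-1) (F (-1) vac)) 1 w)
    + (scale b (Y (E (-2) vac) 1 w) + (scale (- c / 2) (Y (H (-2) vac) 1 w) + scale g (Y (F (-2) vac) 1 w))))))))"
    by (subst (1) w_def, unfold vec_def) (simp only: mode_add_left mode_scale_left UNIV_I)
  also have "\<dots> = quad (32 * a * d - 8 * b * b) (8 * b * c - 16 * a * g) (4 * c * c - 16 * a * k)
      (4 * a * k - 4 * b * g - c * c + 8 * c * d) (8 * c * g - 16 * b * k) (32 * d * k - 8 * g * g)"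
    unfolding mode_1 translate_mode_1
    unfolding w_def quad_def act_0_vec act_1_vec act_minus_1_vec1 vec_arith
    by (rule vec_cong) (simp_all add: field_simps)
  finally show ?thesis by (simp add: w_def quad_def)
qed

text \<open>Multiplying the second equation by \<open>b\<close> and eliminating \<open>b * b\<close> and \<open>b * g\<close> leaves a multiple of \<open>a\<close>;
  \<open>k\<close> is dual.\<close>

lemma idempotent_equations:
  fixes a b c d g k :: complex
  assumes "32 * a * d - 8 * b * b = 2 * a" "8 * b * c - 16 * a * g = 2 * b"
    "4 * c * c - 16 * a * k = 2 * c" "4 * a * k - 4 * b * g - c * c + 8 * c * d = 2 * d"
    "8 * c * g - 16 * b * k = 2 * g" "32 * d * k - 8 * g * g = 2 * k"
  shows "a = 0" "b = 0" "c = 4 * d" "g = 0" "k = 0"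
proof -
  \<comment> \<open>A quarter of the third equation added to the fourth cancels \<open>a * k\<close>
    and \<open>c * c\<close>.\<close>
  have bg: "4 * b * g = 8 * c * d - 2 * d - c / 2" using assms(3,4) by algebra
  have "a = 0" using assms(1,2) bg by algebra
  moreover have "k = 0" using assms(5,6) bg by algebra
  ultimately show "a = 0" "k = 0" "b = 0" "g = 0" using assms(1,6) by auto
  \<comment> \<open>Now c is 0 or 1/2 by the third equation, and \<open>bg\<close> gives d = 0 or d
    = 1/8 accordingly.\<close>
  with assms bg show "c = 4 * d" by algebra
qed

text \<open>The first mode of \<open>scale l \<Omega>\<close> sends that vector to 8 l^2 times
  \<open>\<Omega>\<close>, so \<open>l\<close> is 0 or 1/4 unless \<open>\<Omega>\<close> itself is
  0.\<close>

lemma Omega_multiple_in_Sc: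
  assumes "w = scale l \<Omega>" "Y w 1 w = scale 2 w"
  shows "w = 0 \<or> w = \<omega>"
proof -
  have w: "w = quad 0 0 (2 * l) (l / 2) 0 0" using assms(1) by (simp add: Omega_quad quad_arith mult.commute)
  have "scale (8 * l * l - 2 * l) \<Omega> = Y w 1 w - scale 2 w"
    unfolding w quad_square Omega_quad quad_arith by (simp add: algebra_simps)
  then have "2 * l * (4 * l - 1) = 0 \<or> \<Omega> = 0" using assms(2) by (auto simp: algebra_simps)
  then consider "l = 0" | "l = 1/4" | "\<Omega> = 0" by (auto simp: eq_divide_eq mult.commute)
  then show ?thesis by cases (simp_all add: assms(1) sugawara_eq)
qed

lemma Sc_subset:
  assumes "w \<in> Sc scale UNIV Y vac \<omega>"
  shows "w = 0 \<or> w = \<omega>"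
proof -
  from assms obtain U where sub: "vertex_subalgebra scale UNIV Y vac U"
    and voa: "vertex_operator_algebra scale U Y vac w"
    and eq: "\<And>n u. n \<ge> 0 \<Longrightarrow> u \<in> U \<Longrightarrow> Y w n u = Y \<omega> n u"
    by (auto simp: Sc_def)
  interpret U: vertex_operator_algebra scale U Y vac w by (rule voa)
  obtain c0 where vir: "Y w (m + 1) (Y w (n + 1) v) - Y w (n + 1) (Y w (m + 1) v) =
        scale (of_int (m - n)) (Y w (m + n + 1) v)
        + (if m + n = 0 then scale ((of_int m ^ 3 - of_int m) / 12 * c0) v else 0)" if "v \<in> U" for m n v
    using U.virasoro by blast
  \<comment> \<open>The vector \<open>w\<close> is its own mode -1 on the vacuum, so the Virasoro
    relations with \<open>n = -2\<close> compute the action of its modes on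
    \<open>w\<close>.\<close>
  have w1: "Y w 1 w = scale 2 w"
    using vir[OF U.vac_in_V, of 0 "-2"] by (simp add: creation mode_zero_right)
  have w2: "Y w 2 w = 0"
    using vir[OF U.vac_in_V, of 1 "-2"] by (simp add: creation mode_zero_right)
  from w1 w2 have L: "Y \<omega> 1 w = scale 2 w" "Y \<omega> 2 w = 0"
    using eq[OF _ U.\<omega>_in_V] by simp_all
  from L(1) obtain a b c d g k x y z where v: "w = vec a b c d g k x y z"
    by (rule weight_2_vec)
  \<comment> \<open>Coefficients cannot be compared in L(1)w = 0. Instead half of L(-1)L(1)w is
    exactly the difference between \<open>w\<close> and its symmetric form, so this difference is
    0.\<close>
  have "scale (1/2) (Y \<omega> 0 (Y \<omega> 2 w)) = 0" by (simp add: L mode_zero_right)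
  then have "vec 0 0 0 0 0 0 (x - b) (c / 2 + y) (z - g) = 0"
    by (simp add: v sugawara_2_vec sugawara_0_vec1 vec_arith diff_divide_distrib add_divide_distrib)
  then have "w = vec a b c d g k x y z - vec 0 0 0 0 0 0 (x - b) (c / 2 + y) (z - g)" using v by simp
  then have w: "w = quad a b c d g k" by (simp add: vec_arith quad_def)
  show ?thesis
  proof (cases "quad 1 0 0 0 0 0 = 0")
    case True
    \<comment> \<open>If e(-1)e(-1)1 is 0, then so is the whole module it generates under
      \<open>F 0\<close>, and only the component along \<open>\<Omega>\<close> is left.\<close>
    have F: "F 0 v = 0" if "v = 0" for v using that by (simp add: act_zero)
    note z1 = F[OF True, unfolded act_0_quad, simplified]
    note z2 = F[OF z1, unfolded act_0_quad, simplified]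
    note z3 = F[OF z2, unfolded act_0_quad, simplified]
    note z4 = F[OF z3, unfolded act_0_quad, simplified]
    \<comment> \<open>The denominators come from the vectors \<open>z1\<close> to \<open>z4\<close>,
      the successive images of e(-1)e(-1)1 under \<open>F 0\<close>.\<close>
    have "w = quad a b c d g k - scale a (quad 1 0 0 0 0 0) + scale (b / 2) (quad 0 (-2) 0 0 0 0)
      + scale ((c - 4 * d) / 12) (quad 0 0 (-4) 2 0 0) - scale (g / 12) (quad 0 0 0 0 12 0) - scale (k / 24) (quad 0 0 0 0 0 24)"
      using w True z1 z2 z3 z4 by simp
    also have "\<dots> = scale ((c + 2 * d) / 3) \<Omega>"
      unfolding Omega_quad quad_arith by (rule quad_cong) (simp_all add: field_simps)
    finally show ?thesis using Omega_multiple_in_Sc w1 by blast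
  next
    case nz: False
    show ?thesis
    proof (cases "\<Omega> = 0")
      case True
      \<comment> \<open>Here \<open>\<omega>\<close> is 0 as well, so 2w = L(0)w = 0.\<close>
      then show ?thesis using L(1) by (simp add: sugawara_eq mode_zero_left)
    next
      case False
      define \<delta> where "\<delta> = 4 * a * k - 4 * b * g - c * c + 8 * c * d - 2 * d"
      have D: "quad (32 * a * d - 8 * b * b - 2 * a) (8 * b * c - 16 * a * g - 2 * b)
          (4 * c * c - 16 * a * k - 2 * c) \<delta>
          (8 * c * g - 16 * b * k - 2 * g) (32 * d * k - 8 * g * g - 2 * k) = 0"
        using right_minus_eq[THEN iffD2, OF w1] by (simp only: w quad_square quad_arith \<delta>_def)
      note eqs = quad_eq_0[OF D nz]
      \<comment> \<open>\<open>quad_eq_0\<close> determines w_1 w - 2w only up to multiples of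
        \<open>\<Omega>\<close>; the nonvanishing of \<open>\<Omega>\<close> supplies the sixth
        equation.\<close>
      have "scale (2 * \<delta>) \<Omega> = 0"
        using D by (simp add: eqs Omega_quad quad_arith)
      then have "\<delta> = 0" using False by simp
      then have "4 * c * c - 16 * a * k - 2 * c = 0" using eqs(3) by (simp only: mult_zero_right)
      note idem = idempotent_equations[OF eqs(1,2)[THEN right_minus_eq[THEN iffD1]]
        this[THEN right_minus_eq[THEN iffD1]]
        \<open>\<delta> = 0\<close>[unfolded \<delta>_def, THEN right_minus_eq[THEN iffD1]]
        eqs(4,5)[THEN right_minus_eq[THEN iffD1]]]
      have "w = scale (2 * d) \<Omega>" by (simp add: w idem Omega_quad quad_arith)
      then show ?thesis using Omega_multiple_in_Sc w1 by blast
    qed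
  qed
qed

end

theorem mainTheorem7:
  fixes scale :: "complex \<Rightarrow> 'v::ab_group_add \<Rightarrow> 'v"
    and Y :: "'v \<Rightarrow> int \<Rightarrow> 'v \<Rightarrow> 'v"
    and q :: "tensor_alg \<Rightarrow> 'v"
    and lev :: complex
  assumes "universal_affine_sl2 scale Y q lev"
    and "lev = 0"
  shows "Sc scale UNIV Y (q 1) (sugawara q lev) = {0} \<union> {sugawara q lev}"
proof -
  interpret universal_affine_sl2_level_0 scale Y q
    using assms by (simp add: universal_affine_sl2_level_0_def)
  show ?thesis
    unfolding \<open>lev = 0\<close> using Sc_subset zero_in_Sc sugawara_in_Sc by blast
qed

end
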